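(* Let $A\in\mathbb{R}^{n\times n}$, $C\in\mathbb{R}^{p\times n}$, let $T\ge1$ be an integer, let $r\ge1$, and let $q$ be an integer with $0\le q\le p$. The following are equivalent: (i) The decoder $D_{1,r}^T$ can correct $q$ errors after $T$ steps. (ii) For all $K\subset\{1,\dots,p\}$ with $|K|=q$ and for all $G=\Phi^{(T)}z$ with $z\in\mathbb{R}^n\setminus\{0\}$, $$\sum_{i\in K}\|G_i\|_{\ell_r}<\sum_{i\in K^c}\|G_i\|_{\ell_r}.$$
   Context: For $x\in\mathbb{R}^p$, $\mathrm{supp}(x)=\{i : x_i\neq 0\}$. For a matrix $M\in\mathbb{R}^{p\times T}$, $M_i\in\mathbb{R}^T$ denotes its $i$-th row, and $\|M\|_{\ell_1/\ell_r}=\sum_{i=1}^p\|M_i\|_{\ell_r}$. $K^c$ is the complement of $K$ in $\{1,\dots,p\}$. The linear map $\Phi^{(T)}:\mathbb{R}^n\to\mathbb{R}^{p\times T}$ sends $x$ to the matrix with columns $Cx, CAx,\dots,CA^{T-1}x$. For $y^{(0)},\dots,y^{(T-1)}\in\mathbb{R}^p$, let $Y^{(T)}\in\mathbb{R}^{p\times T}$ be the matrix with columns $y^{(0)},\dots,y^{(T-1)}$. The decoder $D_{1,r}^T$ is $$D_{1,r}^T(y^{(0)},\dots,y^{(T-1)})=\operatorname*{argmin}_{x\in\mathbb{R}^n}\|Y^{(T)}-\Phi^{(T)}x\|_{\ell_1/\ell_r}.$$ The equality $D_{1,r}^T(y^{(0)},\dots,y^{(T-1)})=x^{(0)}$ is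 understood to mean that $x^{(0)}$ is the unique minimizer. The decoder $D_{1,r}^T$ corrects $q$ errors after $T$ steps if for every $x^{(0)}\in\mathbb{R}^n$ and every sequence $e^{(0)},\dots,e^{(T-1)}$ in $\mathbb{R}^p$ for which there is $K\subset\{1,\dots,p\}$ with $|K|\le q$ and $\mathrm{supp}(e^{(t)})\subset K$ for all $t$, we have $D_{1,r}^T(y^{(0)},\dots,y^{(T-1)})=x^{(0)}$, where $y^{(t)}=CA^tx^{(0)}+e^{(t)}$, $t=0,\dots,T-1$. *)

theory Defs
  imports "Jordan_Normal_Form.Matrix"
begin

text \<open>
  Components and rows are indexed from 0, so the index set of sensors is \<open>{..<p}\<close>, where
  \<open>p = dim_row C\<close>; the state space is \<open>carrier_vec n\<close>, where \<open>n = dim_col C\<close>.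
\<close>

definition vec_supp :: "real vec \<Rightarrow> nat set" where
  "vec_supp v = {i. i < dim_vec v \<and> v $ i \<noteq> 0}"

definition lr_norm :: "real \<Rightarrow> real vec \<Rightarrow> real" where
  "lr_norm r v = (\<Sum>j<dim_vec v. \<bar>v $ j\<bar> powr r) powr (1 / r)"

definition l1_lr_norm :: "real \<Rightarrow> real mat \<Rightarrow> real" where
  "l1_lr_norm r M = (\<Sum>i<dim_row M. lr_norm r (row M i))"

definition obs_map :: "real mat \<Rightarrow> real mat \<Rightarrow> nat \<Rightarrow> real vec \<Rightarrow> real mat" where
  "obs_map A C T x = mat_of_cols (dim_row C) (map (\<lambda>t. (C * A ^\<^sub>m t) *\<^sub>v x) [0..<T])"

definition output_mat :: "nat \<Rightarrow> nat \<Rightarrow> (nat \<Rightarrow> real vec) \<Rightarrow> real mat" where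
  "output_mat p T y = mat_of_cols p (map y [0..<T])"

text \<open>
  The decoder is the set of all minimizers, so that \<open>decoder A C T r y = {x}\<close> states that
  \<open>x\<close> is the unique minimizer.
\<close>

definition decoder ::
  "real mat \<Rightarrow> real mat \<Rightarrow> nat \<Rightarrow> real \<Rightarrow> (nat \<Rightarrow> real vec) \<Rightarrow> real vec set" where
  "decoder A C T r y =
    {x. is_arg_min (\<lambda>x. l1_lr_norm r (output_mat (dim_row C) T y - obs_map A C T x))
          (\<lambda>x. x \<in> carrier_vec (dim_col C)) x}"

text \<open>Only the values \<open>e t\<close> and \<open>y t\<close> with \<open>t < T\<close> are relevant.\<close>

definition decoder_corrects ::
  "real mat \<Rightarrow> real mat \<Rightarrow> nat \<Rightarrow> real \<Rightarrow> nat \<Rightarrow> bool" where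
  "decoder_corrects A C T r q \<longleftrightarrow>
    (\<forall>x0 \<in> carrier_vec (dim_col C). \<forall>e.
      (\<forall>t<T. e t \<in> carrier_vec (dim_row C)) \<longrightarrow>
      (\<exists>K \<subseteq> {..<dim_row C}. card K \<le> q \<and> (\<forall>t<T. vec_supp (e t) \<subseteq> K)) \<longrightarrow>
      decoder A C T r (\<lambda>t. (C * A ^\<^sub>m t) *\<^sub>v x0 + e t) = {x0})"

end

theory Submission
  imports Defs "HOL-Analysis.Convex"
begin

text \<open>
  By linearity, \<open>x0\<close> is the unique minimizer for all \<open>x0\<close> iff every row-sparse error matrix \<open>E\<close>
  satisfies \<open>\<parallel>E\<parallel> < \<parallel>E - \<Phi> z\<parallel>\<close> for all \<open>z \<noteq> 0\<close>. Condition (ii) yields this by the triangle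
  inequality for \<open>\<ell>\<^sub>r\<close> on the rows in \<open>K\<close>; conversely, apply it to the error \<open>E\<close> that
  agrees with \<open>\<Phi> z\<close> on the rows in \<open>K\<close> and vanishes elsewhere.
\<close>

section \<open>Minkowski's inequality\<close>

text \<open>For positive arguments this is convexity of the power function. If one argument is 0,
  only a single weighted term \<open>t * z\<close> is left, and \<open>t powr r \<le> t\<close> for
  a weight \<open>t\<close> in [0, 1] suffices.\<close>

lemma powr_convex_nonneg:
  fixes r s x y :: real
  assumes "r \<ge> 1" "0 \<le> s" "s \<le> 1" "x \<ge> 0" "y \<ge> 0"
  shows "(s * x + (1 - s) * y) powr r \<le> s * x powr r + (1 - s) * y powr r"
proof -
  have scale: "(t * z) powr r \<le> t * z powr r" if "0 \<le> t" "t \<le> 1" "z \<ge> 0" for t z :: real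
  proof (cases "t = 0")
    case False
    then have "t powr r \<le> t powr 1"
      using that assms(1) by (intro powr_mono') auto
    then show ?thesis
      using that False by (simp add: powr_mult mult_right_mono)
  qed (use assms(1) in simp)
  consider "x = 0" | "y = 0" | "x > 0" "y > 0"
    using assms by linarith
  then show ?thesis
  proof cases
    case 1
    then show ?thesis using scale[of "1 - s" y] assms by simp
  next
    case 2
    then show ?thesis using scale[of s x] assms by simp
  next
    case 3
    then show ?thesis
      using convex_onD[OF powr_convex[OF assms(1)], of "1 - s" x y] assms by simp
  qed
qed

lemma sum_powr_eq_0:
  fixes f :: "'a \<Rightarrow> real"
  assumes "finite S" "(\<Sum>i\<in>S. \<bar>f i\<bar> powr r) powr (1 / r) = 0" "i \<in> S"
  shows "f i = 0"
proof -
  have "(\<Sum>i\<in>S. \<bar>f i\<bar> powr r) = 0"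
    using assms(2) by simp
  then show ?thesis
    using assms(1,3) by (simp add: sum_nonneg_eq_0_iff)
qed

text \<open>Normalise both functions to norm 1. Up to the factor \<open>?a + ?b\<close>, the sum of
  absolute values is a convex combination of the normalised functions, so convexity of the power
  function can be applied pointwise and then summed.\<close>

lemma Minkowski_sum:
  fixes f g :: "'a \<Rightarrow> real"
  assumes "finite S" "r \<ge> 1"
  shows "(\<Sum>i\<in>S. \<bar>f i + g i\<bar> powr r) powr (1 / r)
    \<le> (\<Sum>i\<in>S. \<bar>f i\<bar> powr r) powr (1 / r) + (\<Sum>i\<in>S. \<bar>g i\<bar> powr r) powr (1 / r)"
    (is "_ \<le> ?a + ?b")
proof -
  \<comment> \<open>A function of norm 0 vanishes on all of \<open>S\<close>, which makes the
    inequality trivial; otherwise division by both norms is possible.\<close>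
  consider "?a = 0" | "?b = 0" | "?a > 0" "?b > 0"
    using powr_ge_zero less_eq_real_def by metis
  then show ?thesis
  proof cases
    case 1
    then show ?thesis using sum_powr_eq_0[OF assms(1) 1] by simp
  next
    case 2
    then show ?thesis using sum_powr_eq_0[OF assms(1) 2] by simp
  next
    case 3
    define a b where "a = ?a" and "b = ?b"
    have pos: "a > 0" "b > 0" using 3 by (simp_all add: a_def b_def)
    have ar: "(\<Sum>i\<in>S. \<bar>f i\<bar> powr r) = a powr r" and br: "(\<Sum>i\<in>S. \<bar>g i\<bar> powr r) = b powr r"
      using assms by (auto simp: a_def b_def powr_powr sum_nonneg)
    \<comment> \<open>The weight is chosen such that \<open>(a + b) * s = a\<close> and
      \<open>(a + b) * (1 - s) = b\<close>.\<close>
    define s where "s = a / (a + b)"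
    have s: "0 \<le> s" "s \<le> 1" "1 - s = b / (a + b)"
      using pos by (auto simp: s_def field_simps)
    have "\<bar>f i + g i\<bar> powr r
      \<le> (a + b) powr r * (s * (\<bar>f i\<bar> powr r / a powr r) + (1 - s) * (\<bar>g i\<bar> powr r / b powr r))" for i
    proof -
      have eq: "\<bar>f i\<bar> + \<bar>g i\<bar> = (a + b) * (s * (\<bar>f i\<bar> / a) + (1 - s) * (\<bar>g i\<bar> / b))"
        using pos by (simp add: s(3) distrib_left) (simp add: s_def)
      have "\<bar>f i + g i\<bar> powr r \<le> (\<bar>f i\<bar> + \<bar>g i\<bar>) powr r"
        using assms by (intro powr_mono2) auto
      also have "\<dots> = (a + b) powr r * (s * (\<bar>f i\<bar> / a) + (1 - s) * (\<bar>g i\<bar> / b)) powr r"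
        unfolding eq using pos s by (subst powr_mult) auto
      also have "\<dots> \<le> (a + b) powr r
          * (s * (\<bar>f i\<bar> / a) powr r + (1 - s) * (\<bar>g i\<bar> / b) powr r)"
        using pos s assms by (intro mult_left_mono powr_convex_nonneg) auto
      finally show ?thesis
        using pos by (simp add: powr_divide)
    qed
    then have "(\<Sum>i\<in>S. \<bar>f i + g i\<bar> powr r)
      \<le> (\<Sum>i\<in>S. (a + b) powr r
          * (s * (\<bar>f i\<bar> powr r / a powr r) + (1 - s) * (\<bar>g i\<bar> powr r / b powr r)))"
      by (rule sum_mono)
    also have "\<dots> = (a + b) powr r * (s * ((\<Sum>i\<in>S. \<bar>f i\<bar> powr r) / a powr r)
        + (1 - s) * ((\<Sum>i\<in>S. \<bar>g i\<bar> powr r) / b powr r))"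
      by (simp only: sum.distrib sum_divide_distrib flip: sum_distrib_left)
    \<comment> \<open>Both quotients are 1 by the normalisation, so the bracket is
      \<open>s + (1 - s) = 1\<close>.\<close>
    also have "\<dots> = (a + b) powr r"
      unfolding ar br using pos by simp
    finally have "(\<Sum>i\<in>S. \<bar>f i + g i\<bar> powr r) powr (1 / r) \<le> ((a + b) powr r) powr (1 / r)"
      using assms by (intro powr_mono2) (auto simp: sum_nonneg)
    also have "\<dots> = a + b"
      using pos assms by (simp add: powr_powr)
    finally show ?thesis
      by (simp add: a_def b_def)
  qed
qed

lemma lr_norm_triangle:
  assumes "r \<ge> 1" "dim_vec u = dim_vec v"
  shows "lr_norm r (u + v) \<le> lr_norm r u + lr_norm r v"
  using Minkowski_sum[of "{..<dim_vec v}" r "($) u" "($) v"] assms by (simp add: lr_norm_def)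

lemma lr_norm_zero [simp]: "lr_norm r (0\<^sub>v k) = 0"
  by (simp add: lr_norm_def)

lemma lr_norm_uminus [simp]: "lr_norm r (- v) = lr_norm r v"
  by (simp add: lr_norm_def)

lemma lr_norm_diff_ge:
  assumes "r \<ge> 1" "u \<in> carrier_vec k" "v \<in> carrier_vec k"
  shows "lr_norm r u - lr_norm r v \<le> lr_norm r (u - v)"
proof -
  have "u = (u - v) + v"
    using assms by (intro eq_vecI) auto
  then show ?thesis
    using lr_norm_triangle[OF assms(1), of "u - v" v] assms by fastforce
qed

section \<open>Unique decoding\<close>

lemma obs_map_dim [simp]:
  "dim_row (obs_map A C T x) = dim_row C" "dim_col (obs_map A C T x) = T"
  unfolding obs_map_def by (simp_all only: mat_of_cols_carrier length_map length_upt diff_zero)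

lemma output_mat_dim [simp]: "dim_row (output_mat p T y) = p" "dim_col (output_mat p T y) = T"
  unfolding output_mat_def by (simp_all only: mat_of_cols_carrier length_map length_upt diff_zero)

lemma obs_map_carrier [simp]: "obs_map A C T x \<in> carrier_mat (dim_row C) T"
  by (rule carrier_matI) simp_all

lemma output_mat_carrier [simp]: "output_mat p T y \<in> carrier_mat p T"
  by (rule carrier_matI) simp_all

lemma obs_map_index:
  "i < dim_row C \<Longrightarrow> t < T \<Longrightarrow> obs_map A C T x $$ (i, t) = ((C * A ^\<^sub>m t) *\<^sub>v x) $ i"
  by (simp add: obs_map_def mat_of_cols_index)

lemma output_mat_index: "i < p \<Longrightarrow> t < T \<Longrightarrow> output_mat p T y $$ (i, t) = y t $ i"
  by (simp add: output_mat_def mat_of_cols_index)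

text \<open>Linearity absorbs the contribution of the true state \<open>x0\<close>: the residual
  depends on \<open>x\<close> only through the estimation error \<open>x - x0\<close>.\<close>

lemma residual_eq:
  assumes A: "A \<in> carrier_mat n n" and C: "C \<in> carrier_mat p n"
    and x: "x \<in> carrier_vec n" and x0: "x0 \<in> carrier_vec n"
    and e: "\<forall>t<T. e t \<in> carrier_vec p"
  shows "output_mat p T (\<lambda>t. (C * A ^\<^sub>m t) *\<^sub>v x0 + e t) - obs_map A C T x
    = output_mat p T e - obs_map A C T (x - x0)"
proof (rule eq_matI)
  fix i t
  assume "i < dim_row (output_mat p T e - obs_map A C T (x - x0))"
    and "t < dim_col (output_mat p T e - obs_map A C T (x - x0))"
  then have it: "i < p" "t < T" using C by auto
  have CA: "C * A ^\<^sub>m t \<in> carrier_mat p n" using A C by auto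
  have "((C * A ^\<^sub>m t) *\<^sub>v (x - x0)) $ i
      = ((C * A ^\<^sub>m t) *\<^sub>v x) $ i - ((C * A ^\<^sub>m t) *\<^sub>v x0) $ i"
    using mult_minus_distrib_mat_vec[OF CA x x0] C it by simp
  then show "(output_mat p T (\<lambda>t. (C * A ^\<^sub>m t) *\<^sub>v x0 + e t) - obs_map A C T x) $$ (i, t)
    = (output_mat p T e - obs_map A C T (x - x0)) $$ (i, t)"
    using it C e by (auto simp: output_mat_index obs_map_index simp del: index_mult_mat_vec)
qed (use C in auto)

lemma obs_map_zero:
  assumes "A \<in> carrier_mat n n" "C \<in> carrier_mat p n"
  shows "obs_map A C T (0\<^sub>v n) = 0\<^sub>m p T"
  using assms by (intro eq_matI) (auto simp: obs_map_index)

text \<open>In a linear order, a competitor that is not strictly worse than a minimizer is itself a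
  minimizer, which uniqueness forbids.\<close>

lemma is_arg_min_singleton:
  fixes f :: "'a \<Rightarrow> 'b :: linorder"
  assumes "P x0"
  shows "{x. is_arg_min f P x} = {x0} \<longleftrightarrow> (\<forall>x. P x \<and> x \<noteq> x0 \<longrightarrow> f x0 < f x)"
proof
  assume L: "{x. is_arg_min f P x} = {x0}"
  then have x0: "is_arg_min f P x0" by auto
  show "\<forall>x. P x \<and> x \<noteq> x0 \<longrightarrow> f x0 < f x"
  proof (intro allI impI, rule ccontr)
    fix x assume x: "P x \<and> x \<noteq> x0" "\<not> f x0 < f x"
    then have "is_arg_min f P x"
      using x0 by (fastforce simp: is_arg_min_linorder)
    with L x show False by auto
  qed
next
  assume "\<forall>x. P x \<and> x \<noteq> x0 \<longrightarrow> f x0 < f x"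
  then show "{x. is_arg_min f P x} = {x0}"
    using assms by (auto simp: is_arg_min_def dest: less_asym)
qed

text \<open>The substitution \<open>z = x - x0\<close> moves the true state to the origin, where the
  residual is the error matrix itself. The resulting condition no longer mentions \<open>x0\<close>,
  so correct decoding is a property of the error alone.\<close>

lemma decoder_eq_singleton_iff:
  assumes A: "A \<in> carrier_mat n n" and C: "C \<in> carrier_mat p n"
    and x0: "x0 \<in> carrier_vec n" and e: "\<forall>t<T. e t \<in> carrier_vec p"
  shows "decoder A C T r (\<lambda>t. (C * A ^\<^sub>m t) *\<^sub>v x0 + e t) = {x0} \<longleftrightarrow>
    (\<forall>z \<in> carrier_vec n - {0\<^sub>v n}.
      l1_lr_norm r (output_mat p T e) < l1_lr_norm r (output_mat p T e - obs_map A C T z))"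
    (is "_ \<longleftrightarrow> ?R")
proof -
  define h where "h z = l1_lr_norm r (output_mat p T e - obs_map A C T z)" for z :: "real vec"
  have "output_mat p T e - 0\<^sub>m p T = output_mat p T e"
    by (intro eq_matI) auto
  then have h0: "h (0\<^sub>v n) = l1_lr_norm r (output_mat p T e)"
    by (simp add: h_def obs_map_zero[OF A C])
  have dims: "dim_row C = p" "dim_col C = n" using C by auto
  have res: "l1_lr_norm r (output_mat p T (\<lambda>t. (C * A ^\<^sub>m t) *\<^sub>v x0 + e t) - obs_map A C T x)
      = h (x - x0)" if "x \<in> carrier_vec n" for x
    unfolding h_def residual_eq[OF A C that x0 e] ..
  have "decoder A C T r (\<lambda>t. (C * A ^\<^sub>m t) *\<^sub>v x0 + e t) = {x0} \<longleftrightarrow>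
      (\<forall>x. x \<in> carrier_vec n \<and> x \<noteq> x0 \<longrightarrow> h (0\<^sub>v n) < h (x - x0))"
    unfolding decoder_def dims using x0
    by (subst is_arg_min_singleton) (auto simp: res)
  \<comment> \<open>Translation by \<open>x0\<close> is a bijection of the state space that matches
    \<open>x \<noteq> x0\<close> with nonzero \<open>z\<close>.\<close>
  also have "\<dots> \<longleftrightarrow> (\<forall>z \<in> carrier_vec n - {0\<^sub>v n}. h (0\<^sub>v n) < h z)"
  proof (intro iffI ballI allI impI)
    fix z :: "real vec"
    assume *: "\<forall>x. x \<in> carrier_vec n \<and> x \<noteq> x0 \<longrightarrow> h (0\<^sub>v n) < h (x - x0)"
      and z: "z \<in> carrier_vec n - {0\<^sub>v n}"
    have eq: "z + x0 - x0 = z" using z x0 by (intro eq_vecI) auto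
    moreover have "x0 - x0 = 0\<^sub>v n" using x0 by simp
    ultimately have "z + x0 \<noteq> x0" using z by auto
    then show "h (0\<^sub>v n) < h z" using *[rule_format, of "z + x0"] z x0 eq by simp
  next
    fix x assume *: "\<forall>z \<in> carrier_vec n - {0\<^sub>v n}. h (0\<^sub>v n) < h z"
      and x: "x \<in> carrier_vec n \<and> x \<noteq> x0"
    have "x - x0 + x0 = x" using x x0 by (intro eq_vecI) auto
    then have "x - x0 \<noteq> 0\<^sub>v n" using x x0 by auto
    then show "h (0\<^sub>v n) < h (x - x0)" using * x x0 by auto
  qed
  finally show ?thesis
    by (simp only: h0) (simp add: h_def)
qed

section \<open>Row-sparse errors and the row sums over \<open>K\<close> and its complement\<close>

lemma l1_lr_norm_split:
  assumes "M \<in> carrier_mat p T" "K \<subseteq> {..<p}"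
  shows "l1_lr_norm r M = (\<Sum>i\<in>K. lr_norm r (row M i)) + (\<Sum>i\<in>{..<p} - K. lr_norm r (row M i))"
  using assms sum.subset_diff[of K "{..<p}" "\<lambda>i. lr_norm r (row M i)"]
  by (auto simp: l1_lr_norm_def)

text \<open>On the rows in \<open>K\<close>, subtracting \<open>G\<close> lowers the norm by at most
  the sum of the row norms of \<open>G\<close> there. Off \<open>K\<close> the rows of
  \<open>E\<close> are zero, so the row norms of \<open>G\<close> are gained in full. By
  \<open>lt\<close> the gain exceeds the loss.\<close>

lemma row_sparse_perturbation:
  assumes "r \<ge> 1" and E: "E \<in> carrier_mat p T" and G: "G \<in> carrier_mat p T"
    and K: "K \<subseteq> {..<p}" and zero: "\<And>i. i \<in> {..<p} - K \<Longrightarrow> row E i = 0\<^sub>v T"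
    and lt: "(\<Sum>i\<in>K. lr_norm r (row G i)) < (\<Sum>i\<in>{..<p} - K. lr_norm r (row G i))"
  shows "l1_lr_norm r E < l1_lr_norm r (E - G)"
proof -
  have row: "row (E - G) i = row E i - row G i" if "i < p" for i
    using E G that by (intro eq_vecI) auto
  have "l1_lr_norm r E = (\<Sum>i\<in>K. lr_norm r (row E i))"
    using zero by (simp add: l1_lr_norm_split[OF E K])
  \<comment> \<open>The only strict step: what is added is the off-\<open>K\<close> sum minus the
    on-\<open>K\<close> sum of \<open>G\<close>, positive by \<open>lt\<close>.\<close>
  also have "\<dots> < (\<Sum>i\<in>K. lr_norm r (row E i) - lr_norm r (row G i))
      + (\<Sum>i\<in>{..<p} - K. lr_norm r (row G i))"
    using lt by (simp add: sum_subtractf)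
  also have "\<dots> \<le> (\<Sum>i\<in>K. lr_norm r (row (E - G) i))
      + (\<Sum>i\<in>{..<p} - K. lr_norm r (row (E - G) i))"
  proof (intro add_mono sum_mono)
    fix i assume "i \<in> K"
    then have "i < p" using K by auto
    then show "lr_norm r (row E i) - lr_norm r (row G i) \<le> lr_norm r (row (E - G) i)"
      using E G assms(1) by (auto simp: row intro!: lr_norm_diff_ge[of _ _ T])
  next
    fix i assume i: "i \<in> {..<p} - K"
    have "0\<^sub>v T - row G i = - row G i"
      using G by (intro eq_vecI) auto
    then show "lr_norm r (row G i) \<le> lr_norm r (row (E - G) i)"
      using i by (simp add: row zero)
  qed
  also have "\<dots> = l1_lr_norm r (E - G)"
    using G by (subst l1_lr_norm_split[OF _ K]) auto
  finally show ?thesis .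
qed

section \<open>Equivalence of error correction and the row-sum condition\<close>

theorem proposition6:
  fixes A C :: "real mat" and n p T q :: nat and r :: real
  assumes "A \<in> carrier_mat n n" and "C \<in> carrier_mat p n"
    and "T \<ge> 1" and "r \<ge> 1" and "q \<le> p"
  shows "decoder_corrects A C T r q \<longleftrightarrow>
    (\<forall>K \<subseteq> {..<p}. card K = q \<longrightarrow>
      (\<forall>z \<in> carrier_vec n - {0\<^sub>v n}. \<forall>G. G = obs_map A C T z \<longrightarrow>
        (\<Sum>i\<in>K. lr_norm r (row G i)) < (\<Sum>i\<in>{..<p} - K. lr_norm r (row G i))))"
proof -
  have dims: "dim_row C = p" "dim_col C = n" using assms(2) by auto
  show ?thesis
  proof (intro iffI allI impI ballI)
    fix K z G
    assume corr: "decoder_corrects A C T r q" and K: "K \<subseteq> {..<p}" "card K = q"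
      and z: "z \<in> carrier_vec n - {0\<^sub>v n}" and G: "G = obs_map A C T z"
    have Gc: "G \<in> carrier_mat p T" using G dims by auto
    \<comment> \<open>The adversarial error copies \<open>G\<close> on the rows in \<open>K\<close>,
      so that the wrong state \<open>z\<close> explains these rows exactly.\<close>
    define e where "e t = vec p (\<lambda>i. if i \<in> K then G $$ (i, t) else 0)" for t
    define E where "E = output_mat p T e"
    have e: "\<forall>t<T. e t \<in> carrier_vec p" by (simp add: e_def)
    have "\<forall>t<T. vec_supp (e t) \<subseteq> K" by (auto simp: vec_supp_def e_def split: if_splits)
    \<comment> \<open>The true state is taken to be 0, so that the measurements consist of the error
      alone and \<open>z\<close> is a competing state.\<close>
    then have "decoder A C T r (\<lambda>t. (C * A ^\<^sub>m t) *\<^sub>v 0\<^sub>v n + e t) = {0\<^sub>v n}"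
      using K e
      by (intro corr[unfolded decoder_corrects_def dims, THEN bspec, THEN spec, THEN mp, THEN mp]) auto
    then have lt: "l1_lr_norm r E < l1_lr_norm r (E - G)"
      using z unfolding decoder_eq_singleton_iff[OF assms(1,2) zero_carrier_vec e] E_def G by blast
    have E: "E \<in> carrier_mat p T" by (simp add: E_def)
    have E_row: "row E i = (if i \<in> K then row G i else 0\<^sub>v T)" if "i < p" for i
      using that Gc by (intro eq_vecI) (auto simp: E_def output_mat_index e_def)
    have EG_row: "row (E - G) i = (if i \<in> K then 0\<^sub>v T else - row G i)" if "i < p" for i
      using that Gc by (intro eq_vecI) (auto simp: E_def output_mat_index e_def)
    \<comment> \<open>The true state 0 leaves the rows of \<open>G\<close> in \<open>K\<close> as
      residual, while \<open>z\<close> leaves the negated rows of \<open>G\<close> off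
      \<open>K\<close>. Comparing the two norms is the claimed inequality.\<close>
    have "l1_lr_norm r E = (\<Sum>i\<in>K. lr_norm r (row G i))"
      using K(1) by (auto simp: l1_lr_norm_split[OF E K(1)] E_row subset_iff intro!: sum.cong)
    moreover have "l1_lr_norm r (E - G) = (\<Sum>i\<in>{..<p} - K. lr_norm r (row G i))"
    proof -
      have "(\<Sum>i\<in>K. lr_norm r (row (E - G) i)) = 0"
        using K(1) by (intro sum.neutral) (auto simp: EG_row subset_iff)
      moreover have "E - G \<in> carrier_mat p T" using Gc by auto
      ultimately show ?thesis
        by (simp add: l1_lr_norm_split[OF _ K(1)] EG_row)
    qed
    ultimately show "(\<Sum>i\<in>K. lr_norm r (row G i)) < (\<Sum>i\<in>{..<p} - K. lr_norm r (row G i))"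
      using lt by simp
  next
    assume R: "\<forall>K \<subseteq> {..<p}. card K = q \<longrightarrow>
      (\<forall>z \<in> carrier_vec n - {0\<^sub>v n}. \<forall>G. G = obs_map A C T z \<longrightarrow>
        (\<Sum>i\<in>K. lr_norm r (row G i)) < (\<Sum>i\<in>{..<p} - K. lr_norm r (row G i)))"
    show "decoder_corrects A C T r q"
      unfolding decoder_corrects_def dims
    proof (intro ballI allI impI)
      fix x0 :: "real vec" and e :: "nat \<Rightarrow> real vec"
      assume x0: "x0 \<in> carrier_vec n" and e: "\<forall>t<T. e t \<in> carrier_vec p"
        and "\<exists>K \<subseteq> {..<p}. card K \<le> q \<and> (\<forall>t<T. vec_supp (e t) \<subseteq> K)"
      then obtain K' where K': "K' \<subseteq> {..<p}" "card K' \<le> q" "\<forall>t<T. vec_supp (e t) \<subseteq> K'"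
        by blast
      \<comment> \<open>The error may touch fewer than \<open>q\<close> rows, whereas
        \<open>R\<close> speaks of sets of exactly \<open>q\<close> rows. Since
        \<open>q \<le> p\<close>, the set \<open>K'\<close> can be enlarged, and the error still
        vanishes off the larger set.\<close>
      obtain K where K: "K' \<subseteq> K" "K \<subseteq> {..<p}" "card K = q"
        using exists_subset_between[of K' q "{..<p}"] K' assms(5) by auto
      have zero: "row (output_mat p T e) i = 0\<^sub>v T" if "i \<in> {..<p} - K" for i
      proof (rule eq_vecI)
        fix t assume "t < dim_vec (0\<^sub>v T :: real vec)"
        moreover from this have "i \<notin> vec_supp (e t)" using K' K that by auto
        ultimately show "row (output_mat p T e) i $ t = 0\<^sub>v T $ t"
          using e that by (auto simp: output_mat_index vec_supp_def)
      qed simp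
      show "decoder A C T r (\<lambda>t. (C * A ^\<^sub>m t) *\<^sub>v x0 + e t) = {x0}"
        unfolding decoder_eq_singleton_iff[OF assms(1,2) x0 e]
      proof
        fix z :: "real vec" assume "z \<in> carrier_vec n - {0\<^sub>v n}"
        then have "(\<Sum>i\<in>K. lr_norm r (row (obs_map A C T z) i))
            < (\<Sum>i\<in>{..<p} - K. lr_norm r (row (obs_map A C T z) i))"
          using R K(2,3) by blast
        moreover have "obs_map A C T z \<in> carrier_mat p T"
          using obs_map_carrier dims by metis
        ultimately show "l1_lr_norm r (output_mat p T e)
            < l1_lr_norm r (output_mat p T e - obs_map A C T z)"
          using row_sparse_perturbation[OF assms(4) output_mat_carrier _ K(2) zero] by blast
      qed
    qed
  qed
qed

end
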